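(* Let $X$ be a real Banach space and let $M \subseteq X$ be an $M$-ideal. If $m^* \in B_{M^*}$ is a $w^*$-denting point of $B_{M^*}$, then $m^*$, regarded as an element of $X^*$ via its unique norm-preserving extension, belongs to $B_{X^*}$ and is a $w^*$-denting point of $B_{X^*}$.
   Context: $B_X$ denotes the closed unit ball of a Banach space $X$, and $X^*$ its dual. For a bounded set $C \subseteq X^*$, $x \in X$ with $\|x\| = 1$ and $\alpha > 0$, the set $\{x^* \in C : x^*(x) > \sup_{c^* \in C} c^*(x) - \alpha\}$ is called a (open) $w^*$-slice of $C$. A point $x^* \neq 0$ of a convex set $K \subseteq X^*$ is a $w^*$-denting point of $K$ if for every $\varepsilon > 0$ there is a $w^*$-slice $S$ of $K$ with $x^* \in S$ and $\operatorname{diam}(S) < \varepsilon$. For $B_{M^*}$, $w^*$-slices are taken with respect to elements of $M$; for $B_{X^*}$, with respect to elements of $X$. A linear projection $P$ on a Banach space $Z$ is an $L$-projection if $\|z\| = \|Pz\| + \|z - Pz\|$ for all $z \in Z$. A closed subspace $M \subseteq X$ is an $M$-ideal if $M^\perp = \{x^* \in X^* : x^*|_M = 0\}$ is the kernel of an $L$-projection on $X^*$. When $M$ is an $M$-ideal in $X$, every $m^* \in M^*$ has a unique norm-preserving extension to an element of $X^*$; identifying $m^*$ with this extension gives $X^* = M^* \oplus_1 M^\perp$ ($\ell^1$-direct sum). *)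

theory Defs
  imports "HOL-Analysis.Analysis"
begin

text \<open>
  The dual of a real Banach space \<open>X\<close> (a type of class \<open>banach\<close>) is the library type
  \<open>'a \<Rightarrow>\<^sub>L real\<close> with its operator norm, and \<open>B_{X*}\<close> is \<open>cball 0 1\<close>.

  A subspace \<open>M\<close> of \<open>X\<close> is a set, so its dual \<open>M*\<close> is not a type. An element of \<open>M*\<close> is
  represented by the function on all of \<open>X\<close> that agrees with it on \<open>M\<close> and takes the value \<open>0\<close>
  off \<open>M\<close>. This representation is unique, and the zero functional is the zero function.
\<close>

definition dual_on :: "'a::real_normed_vector set \<Rightarrow> ('a \<Rightarrow> real) set" where
  "dual_on M = {f.
     (\<forall>x\<in>M. \<forall>y\<in>M. f (x + y) = f x + f y) \<and>
     (\<forall>c. \<forall>x\<in>M. f (c *\<^sub>R x) = c * f x) \<and>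
     (\<exists>B. \<forall>x\<in>M. \<bar>f x\<bar> \<le> B * norm x) \<and>
     (\<forall>x. x \<notin> M \<longrightarrow> f x = 0)}"

definition dual_norm_on :: "'a::real_normed_vector set \<Rightarrow> ('a \<Rightarrow> real) \<Rightarrow> real" where
  "dual_norm_on M f = (SUP x\<in>{x\<in>M. norm x \<le> 1}. \<bar>f x\<bar>)"

definition dual_ball_on :: "'a::real_normed_vector set \<Rightarrow> ('a \<Rightarrow> real) set" where
  "dual_ball_on M = {f \<in> dual_on M. dual_norm_on M f \<le> 1}"

text \<open>Same shape as the library's \<^const>\<open>diameter\<close>, for the metric of \<open>M*\<close>.\<close>

definition dual_diameter_on :: "'a::real_normed_vector set \<Rightarrow> ('a \<Rightarrow> real) set \<Rightarrow> real" where
  "dual_diameter_on M S =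
     (if S = {} then 0 else SUP (f, g)\<in>S \<times> S. dual_norm_on M (\<lambda>x. f x - g x))"

text \<open>
  Slices and denting points in \<open>M*\<close> (tested against unit vectors of \<open>M\<close>), then in \<open>X*\<close> (tested
  against unit vectors of \<open>X\<close>). The real-valued suprema are meaningful for nonempty bounded \<open>C\<close>.
\<close>

definition wstar_slices_on ::
    "'a::real_normed_vector set \<Rightarrow> ('a \<Rightarrow> real) set \<Rightarrow> ('a \<Rightarrow> real) set set" where
  "wstar_slices_on M C =
     {{f \<in> C. f x > (SUP c\<in>C. c x) - \<alpha>} |x \<alpha>. x \<in> M \<and> norm x = 1 \<and> \<alpha> > 0}"

definition wstar_denting_on ::
    "'a::real_normed_vector set \<Rightarrow> ('a \<Rightarrow> real) set \<Rightarrow> ('a \<Rightarrow> real) \<Rightarrow> bool" where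
  "wstar_denting_on M K f \<longleftrightarrow>
     f \<in> K \<and> f \<noteq> (\<lambda>x. 0) \<and>
     (\<forall>\<epsilon>>0. \<exists>S\<in>wstar_slices_on M K. f \<in> S \<and> dual_diameter_on M S < \<epsilon>)"

definition wstar_slices ::
    "('a::real_normed_vector \<Rightarrow>\<^sub>L real) set \<Rightarrow> ('a \<Rightarrow>\<^sub>L real) set set" where
  "wstar_slices C =
     {{f \<in> C. blinfun_apply f x > (SUP c\<in>C. blinfun_apply c x) - \<alpha>} |x \<alpha>. norm x = 1 \<and> \<alpha> > 0}"

definition wstar_denting ::
    "('a::real_normed_vector \<Rightarrow>\<^sub>L real) set \<Rightarrow> ('a \<Rightarrow>\<^sub>L real) \<Rightarrow> bool" where
  "wstar_denting K f \<longleftrightarrow>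
     f \<in> K \<and> f \<noteq> 0 \<and>
     (\<forall>\<epsilon>>0. \<exists>S\<in>wstar_slices K. f \<in> S \<and> diameter S < \<epsilon>)"

definition L_projection :: "('z::banach \<Rightarrow> 'z) \<Rightarrow> bool" where
  "L_projection P \<longleftrightarrow>
     linear P \<and> (\<forall>z. P (P z) = P z) \<and> (\<forall>z. norm z = norm (P z) + norm (z - P z))"

definition annihilator :: "'a::real_normed_vector set \<Rightarrow> ('a \<Rightarrow>\<^sub>L real) set" where
  "annihilator M = {f. \<forall>x\<in>M. blinfun_apply f x = 0}"

definition M_ideal :: "'a::banach set \<Rightarrow> bool" where
  "M_ideal M \<longleftrightarrow>
     subspace M \<and> closed M \<and> (\<exists>P. L_projection P \<and> {f. P f = 0} = annihilator M)"

definition norm_preserving_ext ::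
    "'a::real_normed_vector set \<Rightarrow> ('a \<Rightarrow> real) \<Rightarrow> ('a \<Rightarrow>\<^sub>L real) \<Rightarrow> bool" where
  "norm_preserving_ext M f g \<longleftrightarrow>
     (\<forall>x\<in>M. blinfun_apply g x = f x) \<and> norm g = dual_norm_on M f"

text \<open>
  The identification of \<open>M*\<close> with a subspace of \<open>X*\<close> when \<open>M\<close> is an \<open>M\<close>-ideal. The description is
  meaningful only where the norm-preserving extension exists and is unique.
\<close>

definition the_ext :: "'a::real_normed_vector set \<Rightarrow> ('a \<Rightarrow> real) \<Rightarrow> ('a \<Rightarrow>\<^sub>L real)" where
  "the_ext M f = (THE g. norm_preserving_ext M f g)"

end

theory Submission
  imports Defs
begin

text \<open>
  By Hahn--Banach, an element of the range of the \<open>L\<close>-projection \<open>P\<close> has the same norm as its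
  restriction to \<open>M\<close>. Hence the norm-preserving extension of \<open>m\<close> is unique and lies in the range
  of \<open>P\<close>. A slice of \<open>B_{M*}\<close> contains functionals of norm one, so \<open>m\<close> has norm one. The slice of
  \<open>B_{X*}\<close> given by the same unit vector of \<open>M\<close> and the same \<open>\<alpha>\<close> consists of functionals \<open>h\<close> whose
  restriction to \<open>M\<close> is within \<open>\<epsilon>\<close> of \<open>m\<close>. Then \<open>P h\<close> is within \<open>\<epsilon>\<close> of the extension of \<open>m\<close>, so
  \<open>\<parallel>P h\<parallel> \<ge> 1 - \<epsilon>\<close>, and the \<open>L\<close>-decomposition leaves \<open>\<parallel>h - P h\<parallel> \<le> \<epsilon>\<close>.
\<close>

section \<open>Hahn--Banach extension under a norm bound\<close>

text \<open>
  Partial functionals are represented by their graphs, so that linearity becomes \<^const>\<open>subspace\<close>.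
  A one-sided bound suffices, and it also forces the graph to be single-valued.
\<close>

lemma Hahn_Banach_graph_step:
  fixes G :: "('a::real_normed_vector \<times> real) set"
  assumes sub: "subspace G" and bd: "\<And>x r. (x, r) \<in> G \<Longrightarrow> r \<le> B * norm x" and "B \<ge> 0"
  obtains a where "\<And>x r. (x, r) \<in> span (insert (z, a) G) \<Longrightarrow> r \<le> B * norm x"
proof -
  \<comment> \<open>A value \<open>a\<close> at \<open>z\<close> is admissible when it lies above
    all \<open>s - B * norm (y - z)\<close> and below all \<open>B * norm (y' + z) - s'\<close>.
    \<open>L\<close> collects the lower constraints, and its supremum is the value chosen.\<close>
  define L where "L = {s - B * norm (y - z) | y s. (y, s) \<in> G}"
  have LU: "s - B * norm (y - z) \<le> B * norm (y' + z) - s'"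
    if "(y, s) \<in> G" "(y', s') \<in> G" for y s y' s'
  proof -
    have "(y + y', s + s') \<in> G"
      using subspace_add[OF sub that] by simp
    then have "s + s' \<le> B * norm (y + y')"
      by (rule bd)
    also have "\<dots> \<le> B * (norm (y - z) + norm (y' + z))"
      using norm_triangle_ineq[of "y - z" "y' + z"] \<open>B \<ge> 0\<close> by (intro mult_left_mono) auto
    finally show ?thesis
      by (simp add: algebra_simps)
  qed
  have zero: "(0, 0) \<in> G"
    using subspace_0[OF sub] by (simp add: zero_prod_def)
  have L: "L \<noteq> {}" "bdd_above L"
    unfolding L_def bdd_above_def using zero LU[OF _ zero] by blast+
  define a where "a = Sup L"
  have lower: "s - a \<le> B * norm (y - z)" if "(y, s) \<in> G" for y s
  proof -
    have "s - B * norm (y - z) \<le> a"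
      unfolding a_def by (rule cSup_upper[OF _ L(2)]) (use that in \<open>auto simp: L_def\<close>)
    then show ?thesis by simp
  qed
  have upper: "s + a \<le> B * norm (y + z)" if "(y, s) \<in> G" for y s
  proof -
    have "a \<le> B * norm (y + z) - s"
      unfolding a_def by (rule cSup_least[OF L(1)]) (use LU that in \<open>auto simp: L_def\<close>)
    then show ?thesis by simp
  qed
  have "r \<le> B * norm x" if xr: "(x, r) \<in> span (insert (z, a) G)" for x r
  proof -
    \<comment> \<open>Here \<open>t\<close> is the coefficient of the new vector. Its sign decides
      which of the two constraints applies, after rescaling by the reciprocal of its absolute
      value.\<close>
    obtain t where t: "(x, r) - t *\<^sub>R (z, a) \<in> G"
      using xr unfolding span_breakdown_eq span_eq_iff[THEN iffD2, OF sub] by blast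
    consider "t = 0" | "t > 0" | "t < 0" by linarith
    then show ?thesis
    proof cases
      case 1
      then show ?thesis using t bd by (simp add: zero_prod_def)
    next
      case 2
      have "(1 / t) *\<^sub>R ((x, r) - t *\<^sub>R (z, a)) \<in> G"
        by (rule subspace_scale[OF sub t])
      then have "((1 / t) *\<^sub>R x - z, r / t - a) \<in> G"
        using 2 by (simp add: algebra_simps diff_divide_distrib)
      from upper[OF this] have "r / t \<le> B * (norm x / t)"
        using 2 by simp
      then show ?thesis using 2 by (simp add: field_simps)
    next
      case 3
      have "(- 1 / t) *\<^sub>R ((x, r) - t *\<^sub>R (z, a)) \<in> G"
        by (rule subspace_scale[OF sub t])
      then have "((- 1 / t) *\<^sub>R x + z, - r / t + a) \<in> G"
        using 3 by (simp add: algebra_simps diff_divide_distrib)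
      from lower[OF this] have "- r / t \<le> B * (norm x / (- t))"
        using 3 by simp
      then show ?thesis using 3 by (simp add: field_simps)
    qed
  qed
  then show ?thesis by (rule that)
qed

text \<open>Zorn's lemma gives a maximal subspace of pairs that contains \<open>G\<close> and obeys
  the bound. The one-vector extension shows that it is defined everywhere, so it is the graph of the
  functional sought.\<close>

theorem Hahn_Banach_graph:
  fixes G :: "('a::real_normed_vector \<times> real) set"
  assumes sub: "subspace G" and bd: "\<And>x r. (x, r) \<in> G \<Longrightarrow> r \<le> B * norm x" and "B \<ge> 0"
  obtains g :: "'a \<Rightarrow>\<^sub>L real"
    where "\<And>x r. (x, r) \<in> G \<Longrightarrow> blinfun_apply g x = r" and "norm g \<le> B"
proof -
  define A where "A = {H. G \<subseteq> H \<and> subspace H \<and> (\<forall>(x, r)\<in>H. r \<le> B * norm x)}"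
  have "G \<in> A"
    using sub bd by (auto simp: A_def)
  have "\<Union>C \<in> A" if C: "C \<noteq> {}" "subset.chain A C" for C
  proof -
    have CA: "C \<subseteq> A" and ch: "\<And>H K. H \<in> C \<Longrightarrow> K \<in> C \<Longrightarrow> H \<subseteq> K \<or> K \<subseteq> H"
      using C(2) by (auto simp: subset.chain_def)
    have subC: "subspace H" if "H \<in> C" for H
      using CA that by (auto simp: A_def)
    have "subspace (\<Union>C)"
    proof (rule subspaceI)
      show "0 \<in> \<Union>C"
        using C(1) subC subspace_0 by blast
    next
      fix u v assume "u \<in> \<Union>C" "v \<in> \<Union>C"
      then obtain H where "H \<in> C" "u \<in> H" "v \<in> H"
        using ch by blast
      then show "u + v \<in> \<Union>C"
        using subC subspace_add by blast
    next
      fix c u assume "u \<in> \<Union>C"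
      then show "c *\<^sub>R u \<in> \<Union>C"
        using subC subspace_scale by blast
    qed
    then show ?thesis
      using C(1) CA unfolding A_def by blast
  qed
  then obtain H where "H \<in> A" and max: "\<And>K. K \<in> A \<Longrightarrow> H \<subseteq> K \<Longrightarrow> K = H"
    using subset_Zorn_nonempty[of A] \<open>G \<in> A\<close> by blast
  then have GH: "G \<subseteq> H" and subH: "subspace H" and bdH: "\<And>x r. (x, r) \<in> H \<Longrightarrow> r \<le> B * norm x"
    by (auto simp: A_def)
  have total: "\<exists>r. (z, r) \<in> H" for z
  proof -
    obtain a where a: "\<And>x r. (x, r) \<in> span (insert (z, a) H) \<Longrightarrow> r \<le> B * norm x"
      using Hahn_Banach_graph_step[OF subH bdH \<open>B \<ge> 0\<close>] by blast
    have sup: "insert (z, a) H \<subseteq> span (insert (z, a) H)"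
      by (rule span_superset)
    then have "span (insert (z, a) H) \<in> A"
      using a GH by (auto simp: A_def)
    then show ?thesis
      using max sup by blast
  qed
  have unique: "r = s" if "(x, r) \<in> H" "(x, s) \<in> H" for x r s
    using bdH[of 0 "r - s"] bdH[of 0 "s - r"] subspace_diff[OF subH that]
      subspace_diff[OF subH that(2,1)] by simp
  define f where "f x = (THE r. (x, r) \<in> H)" for x
  have fI: "f x = r" if "(x, r) \<in> H" for x r
    unfolding f_def using that unique by blast
  have fH: "(x, f x) \<in> H" for x
    using total[of x] fI by blast
  \<comment> \<open>The one-sided bound at \<open>x\<close> and at \<open>- x\<close> together
    control the absolute value.\<close>
  have bound: "norm (f x) \<le> B * norm x" for x
    using bdH[OF fH[of x]] bdH[of "- x" "- f x"] subspace_neg[OF subH fH[of x]]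
    by simp
  have bl: "bounded_linear f"
  proof (rule bounded_linear_intro)
    show "f (x + y) = f x + f y" for x y
      using subspace_add[OF subH fH[of x] fH[of y]] by (intro fI) simp
    show "f (c *\<^sub>R x) = c *\<^sub>R f x" for c x
      using subspace_scale[OF subH fH[of x], of c] by (intro fI) simp
    show "norm (f x) \<le> norm x * B" for x
      using bound[of x] by (simp add: mult.commute)
  qed
  show ?thesis
  proof (rule that)
    show "blinfun_apply (Blinfun f) x = r" if "(x, r) \<in> G" for x r
      using that GH fI by (auto simp: bounded_linear_Blinfun_apply[OF bl])
    show "norm (Blinfun f) \<le> B"
      by (rule norm_blinfun_bound[OF \<open>B \<ge> 0\<close>])
        (simp only: bounded_linear_Blinfun_apply[OF bl] bound)
  qed
qed

text \<open>On the line through \<open>x\<close>, sending \<open>x\<close> to \<open>norm x\<close>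
  obeys the bound with constant 1; this functional is then extended.\<close>

lemma norming_functional:
  fixes x :: "'a::real_normed_vector"
  obtains g :: "'a \<Rightarrow>\<^sub>L real" where "blinfun_apply g x = norm x" and "norm g \<le> 1"
proof -
  have "r \<le> 1 * norm y" if "(y, r) \<in> span {(x, norm x)}" for y r
    using that by (auto simp: span_singleton mult_right_mono)
  then obtain g :: "'a \<Rightarrow>\<^sub>L real"
    where "\<And>y r. (y, r) \<in> span {(x, norm x)} \<Longrightarrow> blinfun_apply g y = r" "norm g \<le> 1"
    using Hahn_Banach_graph[OF subspace_span, of "{(x, norm x)}" 1] by auto
  then show ?thesis
    using that span_base[of "(x, norm x)"] by blast
qed

section \<open>The dual of a subspace, its norm, and norm-preserving extensions\<close>

lemma dual_on_diff:
  assumes "f \<in> dual_on M" "g \<in> dual_on M"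
  shows "(\<lambda>x. f x - g x) \<in> dual_on M"
proof -
  obtain B C where "\<forall>x\<in>M. \<bar>f x\<bar> \<le> B * norm x" "\<forall>x\<in>M. \<bar>g x\<bar> \<le> C * norm x"
    using assms by (auto simp: dual_on_def)
  then have "\<forall>x\<in>M. \<bar>f x - g x\<bar> \<le> (B + C) * norm x"
    by (fastforce simp: distrib_right)
  then have "\<exists>B. \<forall>x\<in>M. \<bar>f x - g x\<bar> \<le> B * norm x"
    by blast
  then show ?thesis
    using assms unfolding dual_on_def by (auto simp: algebra_simps)
qed

lemma dual_norm_on_bound:
  assumes "subspace M" "\<And>x. x \<in> M \<Longrightarrow> \<bar>f x\<bar> \<le> B * norm x" "B \<ge> 0"
  shows "dual_norm_on M f \<le> B"
  unfolding dual_norm_on_def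
proof (rule cSUP_least)
  show "{x \<in> M. norm x \<le> 1} \<noteq> {}"
    using subspace_0[OF assms(1)] by auto
  show "\<bar>f x\<bar> \<le> B" if "x \<in> {x \<in> M. norm x \<le> 1}" for x
    using assms(2)[of x] that mult_left_le[of "norm x" B] assms(3) by auto
qed

context
  fixes M :: "'a::real_normed_vector set" and f :: "'a \<Rightarrow> real"
  assumes sub: "subspace M" and f: "f \<in> dual_on M"
begin

lemma dual_norm_on_upper:
  assumes "x \<in> M" "norm x \<le> 1"
  shows "\<bar>f x\<bar> \<le> dual_norm_on M f"
proof -
  obtain B where B: "\<forall>x\<in>M. \<bar>f x\<bar> \<le> B * norm x"
    using f by (auto simp: dual_on_def)
  have "\<bar>f x\<bar> \<le> \<bar>B\<bar>" if "x \<in> M" "norm x \<le> 1" for x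
  proof -
    have "\<bar>f x\<bar> \<le> B * norm x"
      using B that by blast
    also have "\<dots> \<le> \<bar>B\<bar> * 1"
      using that by (intro mult_mono) auto
    finally show ?thesis by simp
  qed
  then have "bdd_above ((\<lambda>x. \<bar>f x\<bar>) ` {x \<in> M. norm x \<le> 1})"
    by (intro bdd_aboveI2[where M="\<bar>B\<bar>"]) auto
  then show ?thesis
    unfolding dual_norm_on_def using assms by (intro cSUP_upper) auto
qed

lemma dual_norm_on_nonneg: "0 \<le> dual_norm_on M f"
  using dual_norm_on_upper[of 0] subspace_0[OF sub] by force

lemma abs_le_dual_norm_on:
  assumes "x \<in> M"
  shows "\<bar>f x\<bar> \<le> dual_norm_on M f * norm x"
proof (cases "x = 0")
  case True
  have "f (0 *\<^sub>R x) = 0 * f x"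
    using f assms unfolding dual_on_def by blast
  then show ?thesis using True by simp
next
  case False
  have "f ((1 / norm x) *\<^sub>R x) = (1 / norm x) * f x"
    using f assms unfolding dual_on_def by blast
  then have "\<bar>f x\<bar> / norm x \<le> dual_norm_on M f"
    using dual_norm_on_upper[of "(1 / norm x) *\<^sub>R x"] subspace_scale[OF sub assms] False
    by simp
  then show ?thesis using False by (simp add: field_simps)
qed

theorem norm_preserving_ext_exists: "\<exists>g. norm_preserving_ext M f g"
proof -
  define G where "G = {(x, r). x \<in> M \<and> r = f x}"
  have "subspace G"
  proof (rule subspaceI)
    have "f (0 *\<^sub>R 0) = 0 * f 0"
      using f subspace_0[OF sub] unfolding dual_on_def by blast
    then show "0 \<in> G"
      unfolding G_def using subspace_0[OF sub] by (simp add: zero_prod_def)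
    show "u + v \<in> G" if "u \<in> G" "v \<in> G" for u v
      using that f subspace_add[OF sub] by (auto simp: G_def dual_on_def)
    show "c *\<^sub>R u \<in> G" if "u \<in> G" for c u
      using that f subspace_scale[OF sub] by (auto simp: G_def dual_on_def)
  qed
  moreover have "r \<le> dual_norm_on M f * norm x" if "(x, r) \<in> G" for x r
    using that abs_le_dual_norm_on[of x] by (auto simp: G_def)
  ultimately obtain g :: "'a \<Rightarrow>\<^sub>L real"
    where g: "\<And>x r. (x, r) \<in> G \<Longrightarrow> blinfun_apply g x = r" and le: "norm g \<le> dual_norm_on M f"
    using Hahn_Banach_graph[of G "dual_norm_on M f"] dual_norm_on_nonneg by blast
  have gf: "blinfun_apply g x = f x" if "x \<in> M" for x
    using g that by (auto simp: G_def)
  \<comment> \<open>Hahn--Banach bounds \<open>norm g\<close> from above only; the reverse holds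
    because \<open>g\<close> restricts to \<open>f\<close>.\<close>
  have "dual_norm_on M f \<le> norm g"
    using norm_blinfun[of g] by (intro dual_norm_on_bound[OF sub]) (auto simp flip: gf)
  then show ?thesis
    using gf le by (auto simp: norm_preserving_ext_def)
qed

end

section \<open>Restriction of functionals to a subspace\<close>

definition dual_restrict :: "'a::real_normed_vector set \<Rightarrow> ('a \<Rightarrow>\<^sub>L real) \<Rightarrow> 'a \<Rightarrow> real" where
  "dual_restrict M g = (\<lambda>x. if x \<in> M then blinfun_apply g x else 0)"

lemma dual_restrict_eq_iff_diff_annihilator:
  "dual_restrict M g = dual_restrict M h \<longleftrightarrow> g - h \<in> annihilator M"
  by (auto simp: dual_restrict_def annihilator_def fun_eq_iff blinfun.diff_left)

lemma dual_restrict_diff: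
  "dual_restrict M (g - h) = (\<lambda>x. dual_restrict M g x - dual_restrict M h x)"
  by (auto simp: dual_restrict_def blinfun.diff_left)

lemma norm_preserving_ext_iff_dual_restrict:
  assumes "f \<in> dual_on M"
  shows "norm_preserving_ext M f g \<longleftrightarrow> dual_restrict M g = f \<and> norm g = dual_norm_on M f"
  using assms by (auto simp: norm_preserving_ext_def dual_restrict_def dual_on_def fun_eq_iff)

context
  fixes M :: "'a::real_normed_vector set"
  assumes sub: "subspace M"
begin

lemma dual_restrict_in_dual_on: "dual_restrict M g \<in> dual_on M"
proof -
  have "\<forall>x\<in>M. \<bar>dual_restrict M g x\<bar> \<le> norm g * norm x"
    using norm_blinfun[of g] by (auto simp: dual_restrict_def)
  then show ?thesis
    using subspace_add[OF sub] subspace_scale[OF sub] unfolding dual_on_def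
    by (auto simp: dual_restrict_def blinfun.add_right blinfun.scaleR_right)
qed

lemma dual_norm_on_restrict_le: "dual_norm_on M (dual_restrict M g) \<le> norm g"
  using norm_blinfun[of g] by (intro dual_norm_on_bound[OF sub]) (auto simp: dual_restrict_def)

lemma dual_restrict_in_dual_ball: "norm g \<le> 1 \<Longrightarrow> dual_restrict M g \<in> dual_ball_on M"
  using dual_restrict_in_dual_on dual_norm_on_restrict_le[of g] by (auto simp: dual_ball_on_def)

text \<open>This makes the suprema that define slices of the two balls at a point of
  \<open>M\<close> agree, so the same \<open>x\<close> and \<alpha> can serve both. One inclusion
  comes from norm-preserving extension, the other from restriction.\<close>

lemma dual_ball_eval_image:
  assumes "x \<in> M"
  shows "(\<lambda>c. c x) ` dual_ball_on M = (\<lambda>c. blinfun_apply c x) ` cball 0 1"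
proof safe
  fix c assume c: "c \<in> dual_ball_on M"
  then obtain g where "norm_preserving_ext M c g"
    using norm_preserving_ext_exists[OF sub] by (auto simp: dual_ball_on_def)
  then show "c x \<in> (\<lambda>c. blinfun_apply c x) ` cball 0 1"
    using c assms by (intro image_eqI[of _ _ g]) (auto simp: norm_preserving_ext_def dual_ball_on_def)
next
  fix c :: "'a \<Rightarrow>\<^sub>L real" assume "c \<in> cball 0 1"
  then show "blinfun_apply c x \<in> (\<lambda>c. c x) ` dual_ball_on M"
    using dual_restrict_in_dual_ball[of c] assms
    by (intro image_eqI[of _ _ "dual_restrict M c"]) (auto simp: dual_restrict_def)
qed

text \<open>Differences of elements of the ball have norm at most 2, so the real supremum in the
  diameter is taken over a bounded set and is a genuine upper bound.\<close>

lemma dual_norm_on_diff_le_diameter: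
  assumes S: "S \<subseteq> dual_ball_on M" and "f \<in> S" "g \<in> S"
  shows "dual_norm_on M (\<lambda>x. f x - g x) \<le> dual_diameter_on M S"
proof -
  have le2: "dual_norm_on M (\<lambda>x. f x - g x) \<le> 2" if "f \<in> S" "g \<in> S" for f g
  proof (rule dual_norm_on_bound[OF sub])
    fix x assume x: "x \<in> M"
    have *: "\<bar>h x\<bar> \<le> norm x" if "h \<in> S" for h
    proof -
      have "h \<in> dual_on M" "dual_norm_on M h \<le> 1"
        using S that by (auto simp: dual_ball_on_def)
      then show ?thesis
        using abs_le_dual_norm_on[OF sub, of h x] x
          mult_right_mono[of "dual_norm_on M h" 1 "norm x"] by auto
    qed
    show "\<bar>f x - g x\<bar> \<le> 2 * norm x"
      using *[OF that(1)] *[OF that(2)] by linarith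
  qed simp
  have "(case (f, g) of (f, g) \<Rightarrow> dual_norm_on M (\<lambda>x. f x - g x)) \<le>
    (SUP (f, g)\<in>S \<times> S. dual_norm_on M (\<lambda>x. f x - g x))"
    using assms le2 by (intro cSUP_upper bdd_aboveI2[where M=2]) auto
  then show ?thesis
    using assms(2) by (auto simp: dual_diameter_on_def)
qed

end

section \<open>L-projections whose kernel is the annihilator\<close>

locale L_projected_annihilator =
  fixes M :: "'a::banach set" and P :: "('a \<Rightarrow>\<^sub>L real) \<Rightarrow> ('a \<Rightarrow>\<^sub>L real)"
  assumes sub: "subspace M" and L_proj: "L_projection P"
    and kernel: "{f. P f = 0} = annihilator M"
begin

lemma P_diff: "P (g - h) = P g - P h"
  using L_proj by (simp add: L_projection_def linear_diff)

lemma P_idem: "P (P h) = P h"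
  using L_proj by (simp add: L_projection_def)

lemma norm_decomp: "norm h = norm (P h) + norm (h - P h)"
  using L_proj unfolding L_projection_def by blast

text \<open>By the kernel condition, \<open>P\<close> forgets exactly what a functional does off
  \<open>M\<close>.\<close>

lemma P_eq_iff_dual_restrict: "P g = P h \<longleftrightarrow> dual_restrict M g = dual_restrict M h"
proof -
  have "P g = P h \<longleftrightarrow> P (g - h) = 0"
    by (simp add: P_diff)
  also have "\<dots> \<longleftrightarrow> g - h \<in> annihilator M"
    using kernel by blast
  finally show ?thesis
    by (simp only: dual_restrict_eq_iff_diff_annihilator)
qed

text \<open>\<open>P g\<close> also restricts to \<open>f\<close>, so its norm is at least that of
  \<open>f\<close>, which is \<open>norm g\<close>. The L-decomposition then leaves nothing for
  \<open>g - P g\<close>.\<close>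

lemma norm_preserving_ext_fixed:
  assumes f: "f \<in> dual_on M" and "norm_preserving_ext M f g"
  shows "P g = g"
proof -
  have "dual_restrict M (P g) = f" "norm g = dual_norm_on M f"
    using assms P_idem P_eq_iff_dual_restrict norm_preserving_ext_iff_dual_restrict[OF f] by metis+
  then show ?thesis
    using norm_decomp[of g] dual_norm_on_restrict_le[OF sub, of "P g"] norm_ge_zero[of "g - P g"]
    by (metis add_le_same_cancel1 antisym eq_iff_diff_eq_0 norm_eq_zero)
qed

lemma norm_preserving_ext_unique:
  assumes f: "f \<in> dual_on M"
  shows "\<exists>!g. norm_preserving_ext M f g"
proof -
  have "g = h" if g: "norm_preserving_ext M f g" and h: "norm_preserving_ext M f h" for g h
  proof -
    have "dual_restrict M g = dual_restrict M h"
      using g h norm_preserving_ext_iff_dual_restrict[OF f] by simp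
    then have "P g = P h"
      by (simp only: P_eq_iff_dual_restrict)
    then show ?thesis
      using norm_preserving_ext_fixed[OF f g] norm_preserving_ext_fixed[OF f h] by simp
  qed
  then show ?thesis
    using norm_preserving_ext_exists[OF sub f] by blast
qed

text \<open>\<open>P h\<close> is the norm-preserving extension of the restriction of
  \<open>h\<close>: that extension is fixed by \<open>P\<close> and has the same image under
  \<open>P\<close> as \<open>h\<close>.\<close>

lemma norm_P: "norm (P h) = dual_norm_on M (dual_restrict M h)"
proof -
  have d: "dual_restrict M h \<in> dual_on M"
    by (rule dual_restrict_in_dual_on[OF sub])
  then obtain k where k: "norm_preserving_ext M (dual_restrict M h) k"
    using norm_preserving_ext_exists[OF sub] by blast
  then have "P h = k"
    using norm_preserving_ext_fixed[OF d k] P_eq_iff_dual_restrict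
      norm_preserving_ext_iff_dual_restrict[OF d] by metis
  then show ?thesis
    using k by (simp add: norm_preserving_ext_def)
qed

lemma wstar_denting_ext:
  assumes dent: "wstar_denting_on M (dual_ball_on M) m" and g: "norm_preserving_ext M m g"
  shows "wstar_denting (cball 0 1) g"
  unfolding wstar_denting_def
proof (intro conjI allI impI)
  have m: "m \<in> dual_on M" "dual_norm_on M m \<le> 1" "m \<noteq> (\<lambda>x. 0)"
    using dent by (auto simp: wstar_denting_on_def dual_ball_on_def)
  have rg: "dual_restrict M g = m" and Pg: "P g = g" and ng: "norm g = dual_norm_on M m"
    using g norm_preserving_ext_iff_dual_restrict[OF m(1)] norm_preserving_ext_fixed[OF m(1)] by auto
  show g1: "g \<in> cball 0 1"
    using ng m(2) by simp
  show "g \<noteq> 0"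
    using rg m(3) by (auto simp: dual_restrict_def)
  fix \<epsilon> :: real assume "\<epsilon> > 0"
  \<comment> \<open>With \<epsilon>/7 as the unit of error, points of the slice \<open>T\<close>
    below lie within three units of \<open>g\<close>, so its diameter is at most six units, strictly
    below \<epsilon>.\<close>
  then obtain S where S: "S \<in> wstar_slices_on M (dual_ball_on M)" "m \<in> S"
    and diam: "dual_diameter_on M S < \<epsilon> / 7"
    using dent by (auto simp: wstar_denting_on_def dest!: spec[of _ "\<epsilon> / 7"])
  from S(1) obtain x \<alpha> where x: "x \<in> M" "norm x = 1" "\<alpha> > 0"
    and S_eq: "S = {f \<in> dual_ball_on M. f x > (SUP c\<in>dual_ball_on M. c x) - \<alpha>}"
    by (auto simp: wstar_slices_on_def)
  define s where "s = (SUP c\<in>cball 0 1. blinfun_apply (c :: 'a \<Rightarrow>\<^sub>L real) x)"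
  define T where "T = {h \<in> cball 0 1. blinfun_apply h x > s - \<alpha>}"
  have S_eq': "S = {f \<in> dual_ball_on M. f x > s - \<alpha>}"
    unfolding S_eq s_def using dual_ball_eval_image[OF sub x(1)] by simp
  have TS: "dual_restrict M h \<in> S" if "h \<in> T" for h
    using that dual_restrict_in_dual_ball[OF sub, of h] x(1)
    by (auto simp: T_def S_eq' dual_restrict_def)
  have near: "norm (P h - g) \<le> \<epsilon> / 7" if "h \<in> T" for h
  proof -
    have "norm (P h - g) = norm (P (h - g))"
      by (simp add: P_diff Pg)
    also have "\<dots> = dual_norm_on M (\<lambda>x. dual_restrict M h x - m x)"
      by (simp add: norm_P dual_restrict_diff rg)
    also have "\<dots> \<le> dual_diameter_on M S"
      using dual_norm_on_diff_le_diameter[OF sub _ TS[OF that] S(2)] by (auto simp: S_eq)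
    finally show ?thesis using diam by simp
  qed
  have s_le: "s \<le> 1"
    unfolding s_def
  proof (rule cSUP_least)
    show "blinfun_apply c x \<le> 1" if "c \<in> cball 0 1" for c :: "'a \<Rightarrow>\<^sub>L real"
      using norm_blinfun[of c x] that x(2) by auto
  qed simp
  \<comment> \<open>A functional norming \<open>x\<close> lies in \<open>T\<close>, and its image
    under \<open>P\<close> still takes the value 1 at \<open>x\<close> because \<open>x\<close> is
    in \<open>M\<close>. Being close to this image, \<open>g\<close> has norm almost 1.\<close>
  have ng_ge: "norm g \<ge> 1 - \<epsilon> / 7"
  proof -
    obtain u :: "'a \<Rightarrow>\<^sub>L real" where u: "blinfun_apply u x = 1" "norm u \<le> 1"
      using norming_functional[of x] x(2) by auto
    then have "u \<in> T"
      using s_le x(3) by (auto simp: T_def)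
    have "dual_restrict M (P u) = dual_restrict M u"
      using P_idem P_eq_iff_dual_restrict by blast
    then have "blinfun_apply (P u) x = 1"
      using u x(1) by (metis dual_restrict_def)
    then have "norm (P u) \<ge> 1"
      using norm_blinfun[of "P u" x] x(2) by simp
    then show ?thesis
      using near[OF \<open>u \<in> T\<close>] norm_triangle_ineq2[of "P u" g] by linarith
  qed
  \<comment> \<open>Since \<open>norm h\<close> is at most 1 and \<open>P h\<close> uses up all but
    two units of it, at most two units remain for \<open>h - P h\<close>; the third is the distance
    from \<open>P h\<close> to \<open>g\<close>.\<close>
  have T_near: "norm (h - g) \<le> \<epsilon> * 3 / 7" if "h \<in> T" for h
  proof -
    have "norm (P h) \<ge> 1 - \<epsilon> * 2 / 7"
      using ng_ge near[OF that] norm_triangle_ineq3[of "P h" g] by linarith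
    then have "norm (h - P h) \<le> \<epsilon> * 2 / 7"
      using norm_decomp[of h] that by (simp add: T_def)
    then show ?thesis
      using near[OF that] norm_triangle_ineq[of "h - P h" "P h - g"] by simp
  qed
  show "\<exists>T\<in>wstar_slices (cball 0 1). g \<in> T \<and> diameter T < \<epsilon>"
  proof (intro bexI conjI)
    show "T \<in> wstar_slices (cball 0 1)"
      unfolding wstar_slices_def T_def s_def using x by blast
    show "g \<in> T"
      using S(2) g g1 x(1) by (auto simp: T_def S_eq' norm_preserving_ext_def)
    have "diameter T \<le> \<epsilon> * 6 / 7"
    proof (rule diameter_le)
      show "norm (h - k) \<le> \<epsilon> * 6 / 7" if "h \<in> T" "k \<in> T" for h k
        using T_near[OF that(1)] T_near[OF that(2)] norm_triangle_ineq4[of "h - g" "k - g"] by simp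
    qed (use \<open>\<epsilon> > 0\<close> in auto)
    then show "diameter T < \<epsilon>"
      using \<open>\<epsilon> > 0\<close> by simp
  qed
qed

end

theorem corollary2p2:
  fixes M :: "'a::banach set" and m :: "'a \<Rightarrow> real"
  assumes "M_ideal M"
    and "m \<in> dual_ball_on M"
    and "wstar_denting_on M (dual_ball_on M) m"
  shows "(\<exists>!g. norm_preserving_ext M m g) \<and>
         the_ext M m \<in> cball 0 1 \<and>
         wstar_denting (cball 0 1) (the_ext M m)"
proof -
  obtain P where "L_projected_annihilator M P"
    using assms(1) by (auto simp: M_ideal_def L_projected_annihilator_def)
  then interpret L_projected_annihilator M P .
  have ex1: "\<exists>!g. norm_preserving_ext M m g"
    using assms(2) by (intro norm_preserving_ext_unique) (simp add: dual_ball_on_def)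
  then have "norm_preserving_ext M m (the_ext M m)"
    unfolding the_ext_def by (rule theI')
  then have "wstar_denting (cball 0 1) (the_ext M m)"
    by (rule wstar_denting_ext[OF assms(3)])
  then show ?thesis
    using ex1 by (simp add: wstar_denting_def)
qed

end
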